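(* Let $k \geq 1$ be an integer, let $d = 2k$, and let $n > d$ be an integer. Then the elementary symmetric polynomial $\sigma_{d,n} \in \mathbb{C}[x_1,\dots,x_n]$ admits the power sum decomposition $$2^{d}\,(n-d)\, d!\, \sigma_{d,n} = \sum_{I \subset [n],\ |I| \leq k} (-1)^{|I|} \binom{n-k-|I|-1}{k-|I|} (n-2|I|) \bigl(\delta(I,1) x_1 + \delta(I,2) x_2 + \dots + \delta(I,n) x_n\bigr)^d .$$
   Context: $[n] = \{1,2,\dots,n\}$. For a set of integers $I$ and an integer $i$, $\delta(I,i) = -1$ if $i \in I$ and $\delta(I,i) = 1$ otherwise. The elementary symmetric polynomial is $\sigma_{d,n} = \sum_{I \subset [n], |I| = d} \prod_{i \in I} x_i$. The sum in the claim runs over all subsets $I$ of $[n]$ (including the empty set) with $|I|\le k$. *)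

theory Defs
  imports Complex_Main "HOL-Library.Poly_Mapping"
begin

text \<open>
  Complex polynomials in the variables \<open>x\<^sub>i\<close> (\<open>i :: nat\<close>), as finitely supported maps from
  exponent vectors to coefficients; multiplication on \<^typ>\<open>(nat \<Rightarrow>\<^sub>0 nat) \<Rightarrow>\<^sub>0 complex\<close> is the
  convolution product. The ring \<open>\<complex>[x\<^sub>1,\<dots>,x\<^sub>n]\<close> is the subring of the polynomials that involve only
  variables with index in \<open>{1..n}\<close>.
\<close>

type_synonym cpoly = "(nat \<Rightarrow>\<^sub>0 nat) \<Rightarrow>\<^sub>0 complex"

definition X :: "nat \<Rightarrow> cpoly" where
  "X i = Poly_Mapping.single (Poly_Mapping.single i 1) 1"

definition elem_sym :: "nat \<Rightarrow> nat \<Rightarrow> cpoly" where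
  "elem_sym d n = (\<Sum>I | I \<subseteq> {1..n} \<and> card I = d. \<Prod>i\<in>I. X i)"

definition \<delta> :: "nat set \<Rightarrow> nat \<Rightarrow> int" where
  "\<delta> I i = (if i \<in> I then - 1 else 1)"

end

theory Submission
  imports Defs "HOL-Library.FuncSet"
begin

text \<open>
  Expanding the \<open>d\<close>-th power of a signed linear form over all index sequences
  \<open>f : {0..<d} \<rightarrow> {1..n}\<close> turns the right-hand side into a combination of the monomials
  \<open>x\<^bsub>f 0\<^esub> \<cdots> x\<^bsub>f (d-1)\<^esub>\<close>. Signs square to 1, so the coefficient of such a monomial only sees the
  set \<open>S\<close> of indices that \<open>f\<close> takes an odd number of times: it is the sum of
  \<open>(-1)\<^bsup>|I - S|\<^esup> w(|I|)\<close> over the sets \<open>I\<close> with at most \<open>k\<close> elements, where \<open>w\<close> is the weight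
  \<open>binom(n-k-i-1, k-i) (n-2i)\<close>. The size of \<open>S\<close> is at most \<open>d\<close>, has the parity of \<open>d\<close>, and is
  \<open>d\<close> exactly when \<open>f\<close> is injective; every monomial of \<open>\<sigma>\<^bsub>d,n\<^esub>\<close> comes from \<open>d!\<close> injective
  sequences. It remains to see that the coefficient is \<open>2\<^sup>d (n-d)\<close> if \<open>|S| = d\<close> and 0 if \<open>|S| < d\<close>
  (lemma \<open>truncated_weight_sum\<close>).

  The key is that, for \<open>i \<le> k\<close>, the number \<open>(n-d-1)! w(i)\<close> is the value at \<open>i\<close> of the product of
  \<open>n-2i\<close> and all \<open>j-i\<close> with \<open>k < j < n-k\<close>, a polynomial of degree \<open>n-d\<close> which vanishes strictly
  between \<open>k\<close> and \<open>n-k\<close> and is symmetric or antisymmetric under \<open>i \<mapsto> n-i\<close>. As \<open>|S|\<close> is even, the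
  sign \<open>(-1)\<^bsup>|I - S|\<^esup>\<close> behaves in the same way when \<open>I\<close> is replaced by its complement. Hence the
  sum over small sets is half of the sum over all sets. In the latter, the part of \<open>I\<close> outside \<open>S\<close>
  contributes a finite difference of order \<open>n-|S|\<close>. This kills a polynomial of degree \<open>n-d\<close> when
  \<open>|S| < d\<close>, and gives, up to sign, \<open>(n-d)!\<close> times its leading coefficient when \<open>|S| = d\<close>; the \<open>2\<^bsup>|S|\<^esup>\<close>
  choices for the part of \<open>I\<close> inside \<open>S\<close> give the factor \<open>2\<^sup>d\<close>.
\<close>

section \<open>Alternating sums over subsets\<close>

text \<open>
  Grouping the sets \<open>L\<close> by size, this is the \<open>m\<close>-th finite difference, \<open>m = |T|\<close>, of a polynomial in
  \<open>|L|\<close> of degree at most \<open>m\<close> that is given by linear factors. Keeping the factors allows an induction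
  on their number: writing \<open>l\<close> for \<open>|L|\<close>, a factor \<open>a - b l\<close> is \<open>(a - b m) + b (m - l)\<close>; the constant
  part leaves a sum with fewer than \<open>m\<close> factors, which vanishes, and \<open>m - l\<close> counts the elements \<open>t\<close>
  of \<open>T - L\<close>, so that exchanging the sums leads to the same problem for the sets \<open>T - {t}\<close>.
\<close>

lemma alternating_sum_linear_factors:
  fixes a b :: "'i \<Rightarrow> 'r::{comm_ring_1, ring_char_0}" and T :: "'t set"
  assumes "finite A" "finite T" "card A \<le> card T"
  shows "(\<Sum>L\<in>Pow T. (- 1) ^ card L * (\<Prod>j\<in>A. a j - b j * of_nat (card L)))
    = (if card A = card T then fact (card T) * prod b A else 0)"
  using assms
proof (induction A arbitrary: T rule: finite_induct)
  case empty
  have "(\<Sum>L\<in>Pow T. (- 1) ^ card L * 1 * 1) = (\<Prod>t\<in>T. (1::'r) - 1)"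
    by (subst prod_diff_conv_sum) (use empty in auto)
  also have "\<dots> = (if T = {} then 1 else 0)"
    using empty by (auto simp: card_gt_0_iff power_0_left)
  finally show ?case
    using empty by auto
next
  case (insert x A)
  define h where "h L = (- 1) ^ card L * (\<Prod>j\<in>A. a j - b j * of_nat (card L))" for L :: "'t set"
  let ?m = "of_nat (card T) :: 'r"
  have fin: "finite L" if "L \<in> Pow T" for L
    using that insert.prems by (auto intro: finite_subset)
  have step: "(a x - b x * of_nat (card L)) * h L
      = (a x - b x * ?m) * h L + b x * (\<Sum>t\<in>T - L. h L)" if "L \<in> Pow T" for L
  proof -
    have "card (T - L) + card L = card T"
      using that insert.prems fin[OF that]
      by (simp add: card_Diff_subset card_mono)
    hence "?m = of_nat (card (T - L)) + of_nat (card L)"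
      by (metis of_nat_add)
    thus ?thesis by (simp add: algebra_simps)
  qed
  have swap: "(\<Sum>L\<in>Pow T. \<Sum>t\<in>T - L. h L) = (\<Sum>t\<in>T. \<Sum>L\<in>Pow (T - {t}). h L)"
  proof -
    have "(\<Sum>L\<in>Pow T. \<Sum>t\<in>T - L. h L) = (\<Sum>L\<in>Pow T. \<Sum>t | t \<in> T \<and> t \<notin> L. h L)"
      by (intro sum.cong) auto
    also have "\<dots> = (\<Sum>t\<in>T. \<Sum>L | L \<in> Pow T \<and> t \<notin> L. h L)"
      using insert.prems by (intro sum.swap_restrict) auto
    also have "\<dots> = (\<Sum>t\<in>T. \<Sum>L\<in>Pow (T - {t}). h L)"
      by (intro sum.cong) auto
    finally show ?thesis .
  qed
  have card_less: "card A < card T"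
    using insert by simp
  have "(\<Sum>L\<in>Pow T. (- 1) ^ card L * (\<Prod>j\<in>insert x A. a j - b j * of_nat (card L)))
      = (\<Sum>L\<in>Pow T. (a x - b x * of_nat (card L)) * h L)"
    using insert.hyps by (intro sum.cong) (auto simp: h_def mult_ac)
  also have "\<dots> = (a x - b x * ?m) * (\<Sum>L\<in>Pow T. h L)
      + b x * (\<Sum>t\<in>T. \<Sum>L\<in>Pow (T - {t}). h L)"
    using step by (simp add: sum.distrib sum_distrib_left flip: swap)
  also have "(\<Sum>L\<in>Pow T. h L) = 0"
    using insert.IH[of T] insert.prems card_less by (simp add: h_def)
  also have "(\<Sum>t\<in>T. \<Sum>L\<in>Pow (T - {t}). h L)
      = (\<Sum>t\<in>T. if card A = card T - 1 then fact (card T - 1) * prod b A else 0)"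
  proof (intro sum.cong refl)
    fix t assume "t \<in> T"
    thus "(\<Sum>L\<in>Pow (T - {t}). h L)
        = (if card A = card T - 1 then fact (card T - 1) * prod b A else 0)"
      using insert.IH[of "T - {t}"] insert.prems card_less by (simp add: h_def)
  qed
  also have "\<dots> = (if card (insert x A) = card T then ?m * (fact (card T - 1) * prod b A) else 0)"
    using insert.hyps card_less by auto
  also have "(a x - b x * ?m) * 0 + b x * \<dots>
      = (if card (insert x A) = card T then fact (card T) * prod b (insert x A) else 0)"
    using insert.hyps card_less
    by (auto simp: fact_reduce[of "card T"] mult_ac)
  finally show ?case .
qed

text \<open>
  Split \<open>I\<close> into its parts \<open>J\<close> inside and \<open>L\<close> outside \<open>S\<close>. For each fixed \<open>J\<close> the sum over \<open>L\<close> is a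
  finite difference of a shifted polynomial, whose value does not depend on the shift \<open>|J|\<close>.
\<close>

lemma alternating_sum_outside:
  fixes a b :: "'i \<Rightarrow> 'r::{comm_ring_1, ring_char_0}"
  assumes "finite A" "finite N" "S \<subseteq> N" "card A \<le> card (N - S)"
  shows "(\<Sum>I\<in>Pow N. (- 1) ^ card (I - S) * (\<Prod>j\<in>A. a j - b j * of_nat (card I)))
    = (if card A = card (N - S) then 2 ^ card S * fact (card (N - S)) * prod b A else 0)"
proof -
  let ?g = "\<lambda>I. (- 1) ^ card (I - S) * (\<Prod>j\<in>A. a j - b j * of_nat (card I)) :: 'r"
  have fS: "finite S" using assms finite_subset by auto
  have "(\<Sum>I\<in>Pow N. ?g I) = (\<Sum>(J, L)\<in>Pow S \<times> Pow (N - S). ?g (J \<union> L))"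
    by (rule sum.reindex_bij_witness[where i = "\<lambda>(J, L). J \<union> L" and j = "\<lambda>I. (I \<inter> S, I - S)"])
       (use assms in \<open>auto simp: Int_Diff_Un\<close>)
  also have "\<dots> = (\<Sum>J\<in>Pow S. \<Sum>L\<in>Pow (N - S). (- 1) ^ card L
      * (\<Prod>j\<in>A. (a j - b j * of_nat (card J)) - b j * of_nat (card L)))"
    unfolding sum.cartesian_product[symmetric]
  proof (intro sum.cong refl)
    fix J L assume JL: "J \<in> Pow S" "L \<in> Pow (N - S)"
    hence "finite J" "finite L" "J \<inter> L = {}" "J \<union> L - S = L"
      using fS assms(2) by (auto intro: finite_subset)
    thus "?g (J \<union> L) = (- 1) ^ card L
        * (\<Prod>j\<in>A. (a j - b j * of_nat (card J)) - b j * of_nat (card L))"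
      by (simp add: card_Un_disjoint algebra_simps)
  qed
  also have "\<dots> = (\<Sum>J\<in>Pow S. if card A = card (N - S)
      then fact (card (N - S)) * prod b A else 0)"
    using assms by (intro sum.cong refl alternating_sum_linear_factors) auto
  finally show ?thesis
    using fS by (simp add: card_Pow mult_ac)
qed

section \<open>The weights\<close>

text \<open>
  The weight \<open>binom(n-k-i-1, k-i) (n-2i)\<close> multiplied by \<open>(n-2k-1)!\<close> and continued as a polynomial in
  \<open>i\<close> to all \<open>i \<le> n\<close>. Integer values are needed since the factors change sign.
\<close>

definition weight_poly :: "nat \<Rightarrow> nat \<Rightarrow> nat \<Rightarrow> int" where
  "weight_poly n k i = (int n - 2 * int i) * (\<Prod>j\<in>{k+1..<n-k}. int j - int i)"

lemma weight_poly_eq_binomial: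
  assumes "i \<le> k" "2 * k < n"
  shows "weight_poly n k i
    = fact (n - 2 * k - 1) * (int ((n - k - i - 1) choose (k - i)) * int (n - 2 * i))"
proof -
  let ?p = "n - k - i - 1"
  have "(\<Prod>j\<in>{k+1..<n-k}. int j - int i) = (\<Prod>j\<in>{k-i+1..?p}. int j)"
    by (rule prod.reindex_bij_witness[where i = "\<lambda>j. j + i" and j = "\<lambda>j. j - i"])
       (use assms in auto)
  hence "int (fact (k - i)) * (\<Prod>j\<in>{k+1..<n-k}. int j - int i)
      = int (\<Prod>{1..k-i} * \<Prod>{k-i+1..?p})"
    by (simp add: fact_prod)
  also have "\<Prod>{1..k-i} * \<Prod>{k-i+1..?p} = \<Prod>({1..k-i} \<union> {k-i+1..?p})"
    by (subst prod.union_disjoint) auto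
  also have "{1..k-i} \<union> {k-i+1..?p} = {1..?p}"
    using assms by auto
  also have "\<Prod>{1..?p} = fact ?p"
    by (simp add: fact_prod)
  also have "fact ?p = fact (k - i) * fact (?p - (k - i)) * (?p choose (k - i))"
    using assms by (intro binomial_fact_lemma[symmetric]) auto
  also have "?p - (k - i) = n - 2 * k - 1"
    using assms by auto
  finally have "(\<Prod>j\<in>{k+1..<n-k}. int j - int i)
      = fact (n - 2 * k - 1) * int (?p choose (k - i))"
    by simp
  thus ?thesis
    using assms by (simp add: weight_poly_def of_nat_diff mult_ac)
qed

lemma weight_poly_eq_0:
  assumes "k < i" "i < n - k"
  shows "weight_poly n k i = 0"
  using assms by (auto simp: weight_poly_def prod_zero_iff)

text \<open>
  Under \<open>i \<mapsto> n-i\<close> and \<open>j \<mapsto> n-j\<close>, each of the \<open>n-2k\<close> linear factors changes sign, and \<open>n-2k\<close> has the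
  parity of \<open>n\<close>.
\<close>

lemma weight_poly_reflect:
  assumes "i \<le> n" "2 * k < n"
  shows "weight_poly n k (n - i) = (- 1) ^ n * weight_poly n k i"
proof -
  have "(\<Prod>j\<in>{k+1..<n-k}. int j - int (n - i)) = (\<Prod>j\<in>{k+1..<n-k}. - 1 * (int j - int i))"
    by (rule prod.reindex_bij_witness[where i = "\<lambda>j. n - j" and j = "\<lambda>j. n - j"])
       (use assms in auto)
  also have "\<dots> = (- 1) ^ (n - k - (k + 1)) * (\<Prod>j\<in>{k+1..<n-k}. int j - int i)"
    unfolding prod.distrib by simp
  finally have reflect: "weight_poly n k (n - i) = (- 1) ^ Suc (n - k - (k + 1)) * weight_poly n k i"
    using assms by (simp add: weight_poly_def of_nat_diff algebra_simps)
  have "even (Suc (n - k - (k + 1))) \<longleftrightarrow> even n"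
    using assms by auto
  hence "(- 1) ^ Suc (n - k - (k + 1)) = ((- 1) ^ n :: int)"
    by (simp only: uminus_power_if power_one)
  with reflect show ?thesis
    by (simp only:)
qed

lemma weight_poly_alternating_sum:
  assumes "finite N" "S \<subseteq> N" "card S \<le> 2 * k" "2 * k < card N"
  shows "(\<Sum>I\<in>Pow N. (- 1) ^ card (I - S) * weight_poly (card N) k (card I))
    = (if card S = 2 * k then 2 * 2 ^ (2 * k) * fact (card N - 2 * k) else 0)"
proof -
  let ?n = "card N"
  \<comment> \<open>The spare index \<open>k\<close> carries the factor \<open>n-2i\<close>, whose slope accounts for the leading 2.\<close>
  let ?A = "{k..<?n-k}"
  define a b where "a j = (if j = k then int ?n else int j)"
    and "b j = (if j = k then 2 else 1 :: int)" for j
  have A: "?A = insert k {k+1..<?n-k}"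
    using assms by auto
  have lin: "weight_poly ?n k i = (\<Prod>j\<in>?A. a j - b j * of_nat i)" for i
    unfolding A by (simp add: weight_poly_def a_def b_def)
  have b: "prod b ?A = 2"
    unfolding A by (simp add: b_def)
  have "card (N - S) = ?n - card S"
    using assms by (simp add: card_Diff_subset finite_subset)
  moreover have "card S \<le> ?n"
    using assms by (simp add: card_mono)
  ultimately show ?thesis
    unfolding lin
    by (subst alternating_sum_outside) (use assms b in auto)
qed

text \<open>
  The terms with \<open>k < |I| < n-k\<close> of the polynomial weights vanish, and complementation matches the
  sets of size at least \<open>n-k\<close> with those of size at most \<open>k\<close>. Evenness of \<open>|S|\<close> makes matched terms
  equal instead of opposite, so the truncated sum is half of the full one.
\<close>

lemma truncated_weight_sum:
  assumes "finite N" "S \<subseteq> N" "card S \<le> 2 * k" "2 * k < card N" "even (card S)"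
  shows "(\<Sum>I | I \<subseteq> N \<and> card I \<le> k. (- 1) ^ card (I - S)
      * (int ((card N - k - card I - 1) choose (k - card I)) * int (card N - 2 * card I)))
    = (if card S = 2 * k then 2 ^ (2 * k) * int (card N - 2 * k) else 0)"
    (is "(\<Sum>I | ?small I. ?s I * ?w I) = ?rhs")
proof -
  let ?n = "card N" and ?F = "fact (card N - 2 * k - 1) :: int"
  define g where "g I = (- 1) ^ card (I - S) * weight_poly ?n k (card I)" for I
  let ?Lo = "{I. I \<subseteq> N \<and> card I \<le> k}" and ?Hi = "{I. I \<subseteq> N \<and> ?n - k \<le> card I}"
  have fin: "finite I" if "I \<subseteq> N" for I
    using that assms by (auto intro: finite_subset)
  have g_compl: "g (N - I) = g I" if I: "I \<subseteq> N" for I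
  proof -
    have c: "card (N - I) = ?n - card I" "card I \<le> ?n"
      using I assms fin by (auto simp: card_Diff_subset card_mono)
    have "card ((N - I) - S) + card (I - S) = card (((N - I) - S) \<union> (I - S))"
      using fin[OF I] assms(1) by (subst card_Un_disjoint) auto
    also have "((N - I) - S) \<union> (I - S) = N - S"
      using I by auto
    also have "card (N - S) + card S = ?n"
      using assms by (simp add: card_Diff_subset finite_subset card_mono)
    finally have "even (card ((N - I) - S)) \<longleftrightarrow> even (?n + card (I - S))"
      using assms(5) by presburger
    thus ?thesis
      using weight_poly_reflect[OF c(2) assms(4)]
      by (auto simp: g_def c uminus_power_if)
  qed
  have "(\<Sum>I\<in>Pow N. g I) = (\<Sum>I\<in>?Lo \<union> ?Hi. g I)"
    using assms(1) by (intro sum.mono_neutral_right) (auto simp: g_def intro: weight_poly_eq_0)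
  also have "\<dots> = (\<Sum>I\<in>?Lo. g I) + (\<Sum>I\<in>?Hi. g I)"
    using assms by (intro sum.union_disjoint) auto
  also have "(\<Sum>I\<in>?Hi. g I) = (\<Sum>I\<in>?Lo. g I)"
    by (rule sum.reindex_bij_witness[where i = "\<lambda>I. N - I" and j = "\<lambda>I. N - I"])
       (use assms fin g_compl in \<open>auto simp: card_Diff_subset double_diff\<close>)
  also have "(\<Sum>I\<in>?Lo. g I) = ?F * (\<Sum>I\<in>?Lo. ?s I * ?w I)"
    unfolding sum_distrib_left
    using assms(4) by (intro sum.cong) (auto simp: g_def weight_poly_eq_binomial)
  finally have "2 * (?F * (\<Sum>I\<in>?Lo. ?s I * ?w I)) = (\<Sum>I\<in>Pow N. g I)"
    by simp
  also have "\<dots> = (if card S = 2 * k then 2 * 2 ^ (2 * k) * fact (?n - 2 * k) else 0)"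
    unfolding g_def using assms by (intro weight_poly_alternating_sum)
  also have "\<dots> = 2 * (?F * ?rhs)"
    using assms(4) fact_reduce[of "?n - 2 * k", where 'a = int] by simp
  finally show ?thesis
    by simp
qed

section \<open>Expanding powers of linear forms\<close>

lemma sum_power_eq_sum_PiE:
  fixes c :: "'i \<Rightarrow> 'r::comm_semiring_1"
  assumes "finite B"
  shows "(\<Sum>i\<in>B. c i) ^ d = (\<Sum>f\<in>{..<d} \<rightarrow>\<^sub>E B. \<Prod>j<d. c (f j))"
  using prod_sum_PiE[of "{..<d}" "\<lambda>_. B" "\<lambda>_. c"] assms by simp

text \<open>
  Group the injections by their image \<open>I\<close>: each of the \<open>d!\<close> bijections onto \<open>I\<close> gives the same
  product.
\<close>

lemma sum_prod_over_injections:
  fixes c :: "'i \<Rightarrow> 'r::comm_semiring_1"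
  assumes "finite B"
  shows "(\<Sum>f | f \<in> {..<d} \<rightarrow>\<^sub>E B \<and> inj_on f {..<d}. \<Prod>j<d. c (f j))
    = of_nat (fact d) * (\<Sum>I | I \<subseteq> B \<and> card I = d. \<Prod>i\<in>I. c i)"
proof -
  let ?E = "{f. f \<in> {..<d} \<rightarrow>\<^sub>E B \<and> inj_on f {..<d}}" and ?C = "{I. I \<subseteq> B \<and> card I = d}"
  have fin: "finite ?E" "finite ?C"
    using assms by (simp_all add: finite_PiE)
  have maps: "(\<lambda>f. f ` {..<d}) ` ?E \<subseteq> ?C"
    using card_image[where A = "{..<d}"] by fastforce
  have inner: "(\<Sum>f | f \<in> ?E \<and> f ` {..<d} = I. \<Prod>j<d. c (f j)) = of_nat (fact d) * prod c I"
    if I: "I \<in> ?C" for I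
  proof -
    have fI: "finite I" using I assms by (auto intro: finite_subset)
    have set_eq: "{f. f \<in> ?E \<and> f ` {..<d} = I} = {f \<in> {..<d} \<rightarrow>\<^sub>E I. inj_on f {..<d}}"
    proof (intro equalityI subsetI)
      fix f assume "f \<in> {f \<in> {..<d} \<rightarrow>\<^sub>E I. inj_on f {..<d}}"
      moreover from this have "f ` {..<d} \<subseteq> I" "card (f ` {..<d}) = d"
        using card_image[of f "{..<d}"] by auto
      hence "f ` {..<d} = I"
        using I card_subset_eq[OF fI] by simp
      ultimately show "f \<in> {f. f \<in> ?E \<and> f ` {..<d} = I}"
        using I by blast
    qed blast
    have "(\<Sum>f | f \<in> ?E \<and> f ` {..<d} = I. \<Prod>j<d. c (f j))
        = (\<Sum>f | f \<in> ?E \<and> f ` {..<d} = I. prod c I)"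
    proof (intro sum.cong refl)
      fix f assume "f \<in> {f. f \<in> ?E \<and> f ` {..<d} = I}"
      hence "inj_on f {..<d}" "f ` {..<d} = I"
        by blast+
      thus "(\<Prod>j<d. c (f j)) = prod c I"
        using prod.reindex[of f "{..<d}" c] by (simp add: o_def)
    qed
    also have "\<dots> = of_nat (card {f \<in> {..<d} \<rightarrow>\<^sub>E I. inj_on f {..<d}}) * prod c I"
      unfolding set_eq by (rule sum_constant)
    also have "card {f \<in> {..<d} \<rightarrow>\<^sub>E I. inj_on f {..<d}} = fact d"
      using I fI by (subst card_inj_on_subset_funcset) (auto simp: fact_prod_rev)
    finally show ?thesis by simp
  qed
  show ?thesis
    unfolding sum.group[OF fin maps, symmetric] sum_distrib_left
    by (intro sum.cong refl inner)
qed

definition odd_fibres :: "nat \<Rightarrow> (nat \<Rightarrow> nat) \<Rightarrow> nat set" where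
  "odd_fibres d f = {i \<in> f ` {..<d}. odd (card {j \<in> {..<d}. f j = i})}"

lemma finite_odd_fibres: "finite (odd_fibres d f)"
  by (simp add: odd_fibres_def)

lemma card_odd_fibres_le: "card (odd_fibres d f) \<le> d"
proof -
  have "card (odd_fibres d f) \<le> card (f ` {..<d})"
    by (rule card_mono) (auto simp: odd_fibres_def)
  also have "\<dots> \<le> d"
    using card_image_le[of "{..<d}" f] by simp
  finally show ?thesis .
qed

text \<open>
  The odd fibres lie over the image of \<open>f\<close>, which has \<open>d\<close> points only if \<open>f\<close> is injective; conversely
  all nonempty fibres of an injective \<open>f\<close> are singletons.
\<close>

lemma card_odd_fibres_eq_iff: "card (odd_fibres d f) = d \<longleftrightarrow> inj_on f {..<d}"
proof
  assume "card (odd_fibres d f) = d"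
  moreover have "card (odd_fibres d f) \<le> card (f ` {..<d})"
    by (rule card_mono) (auto simp: odd_fibres_def)
  moreover have "card (f ` {..<d}) \<le> d"
    using card_image_le[of "{..<d}" f] by simp
  ultimately show "inj_on f {..<d}"
    by (intro eq_card_imp_inj_on) auto
next
  assume inj: "inj_on f {..<d}"
  have "{j \<in> {..<d}. f j = f i} = {i}" if "i < d" for i
    using inj that by (auto simp: inj_on_def)
  hence "odd_fibres d f = f ` {..<d}"
    by (auto simp: odd_fibres_def)
  thus "card (odd_fibres d f) = d"
    using inj by (simp add: card_image)
qed

text \<open>
  The fibre sizes add up to \<open>d\<close>, so \<open>d\<close> has the parity of the number of odd ones.
\<close>

lemma even_card_odd_fibres: "even (card (odd_fibres d f)) \<longleftrightarrow> even d"
proof -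
  have "(\<Sum>i\<in>f ` {..<d}. \<Sum>j | j \<in> {..<d} \<and> f j = i. 1::nat) = (\<Sum>j<d. 1)"
    by (rule sum.group) auto
  hence "d = (\<Sum>i\<in>f ` {..<d}. card {j \<in> {..<d}. f j = i})"
    by simp
  thus ?thesis
    using even_sum_iff[of "f ` {..<d}" "\<lambda>i. card {j \<in> {..<d}. f j = i}"]
    by (simp add: odd_fibres_def)
qed

lemma prod_delta_eq_prod_odd_fibres: "(\<Prod>j<d. \<delta> I (f j)) = (\<Prod>i\<in>odd_fibres d f. \<delta> I i)"
proof -
  have "(\<Prod>j<d. \<delta> I (f j)) = (\<Prod>i\<in>f ` {..<d}. \<Prod>j | j \<in> {..<d} \<and> f j = i. \<delta> I (f j))"
    by (rule prod.group[symmetric]) auto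
  also have "\<dots> = (\<Prod>i\<in>f ` {..<d}. \<delta> I i ^ card {j \<in> {..<d}. f j = i})"
    by (intro prod.cong refl) simp
  also have "\<dots> = (\<Prod>i\<in>f ` {..<d}. if odd (card {j \<in> {..<d}. f j = i}) then \<delta> I i else 1)"
    by (intro prod.cong refl) (auto simp: \<delta>_def)
  also have "\<dots> = (\<Prod>i\<in>odd_fibres d f. \<delta> I i)"
    unfolding odd_fibres_def by (rule prod.inter_filter[symmetric]) simp
  finally show ?thesis .
qed

text \<open>
  The product contributes \<open>-1\<close> for each element of \<open>I \<inter> S\<close>, cancelling the part of \<open>(-1)\<^bsup>|I|\<^esup>\<close> that
  comes from \<open>I \<inter> S\<close>.
\<close>

lemma sign_times_prod_delta:
  assumes "finite I" "finite S"
  shows "(- 1) ^ card I * (\<Prod>i\<in>S. \<delta> I i) = (- 1) ^ card (I - S)"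
proof -
  have "(\<Prod>i\<in>S. \<delta> I i) = (\<Prod>i\<in>I \<inter> S. - 1)"
    using assms by (intro prod.mono_neutral_cong_right) (auto simp: \<delta>_def)
  moreover have "card I = card (I - S) + card (I \<inter> S)"
    using card_Int_Diff[OF assms(1), of S] by simp
  ultimately show ?thesis
    by (simp add: power_add mult.assoc flip: power_mult_distrib)
qed

theorem theorem4p1:
  fixes k d n :: nat
  assumes "k \<ge> 1" and "d = 2 * k" and "n > d"
  shows "2 ^ d * of_nat (n - d) * of_nat (fact d) * elem_sym d n =
    (\<Sum>I | I \<subseteq> {1..n} \<and> card I \<le> k.
      (- 1) ^ card I * of_nat ((n - k - card I - 1) choose (k - card I)) * of_nat (n - 2 * card I)
        * (\<Sum>i = 1..n. of_int (\<delta> I i) * X i) ^ d)"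
proof -
  let ?E = "{..<d} \<rightarrow>\<^sub>E {1..n}" and ?Lo = "{I. I \<subseteq> {1..n} \<and> card I \<le> k}"
  define w where "w I = int ((n - k - card I - 1) choose (k - card I)) * int (n - 2 * card I)"
    for I :: "nat set"
  have finE: "finite ?E"
    by (intro finite_PiE) auto
  have coeff: "(\<Sum>I\<in>?Lo. (- 1) ^ card I * w I * (\<Prod>j<d. \<delta> I (f j)))
      = (if inj_on f {..<d} then 2 ^ d * int (n - d) else 0)" if f: "f \<in> ?E" for f
  proof -
    let ?S = "odd_fibres d f"
    have "(\<Sum>I\<in>?Lo. (- 1) ^ card I * w I * (\<Prod>j<d. \<delta> I (f j)))
        = (\<Sum>I\<in>?Lo. (- 1) ^ card (I - ?S) * w I)"
    proof (intro sum.cong refl)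
      fix I assume "I \<in> ?Lo"
      hence "finite I"
        by (auto intro: finite_subset)
      thus "(- 1) ^ card I * w I * (\<Prod>j<d. \<delta> I (f j)) = (- 1) ^ card (I - ?S) * w I"
        using sign_times_prod_delta[OF _ finite_odd_fibres, of I d f]
        by (simp add: prod_delta_eq_prod_odd_fibres mult_ac)
    qed
    also have "\<dots> = (if card ?S = 2 * k then 2 ^ (2 * k) * int (n - 2 * k) else 0)"
    proof -
      have "?S \<subseteq> {1..n}"
        using f by (auto simp: odd_fibres_def PiE_iff)
      moreover have "card ?S \<le> 2 * k" "even (card ?S)"
        using card_odd_fibres_le[of d f] even_card_odd_fibres[of d f] assms by auto
      ultimately show ?thesis
        using truncated_weight_sum[of "{1..n}" ?S k] assms by (simp add: w_def)
    qed
    finally show ?thesis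
      using card_odd_fibres_eq_iff[of d f] assms(2) by simp
  qed
  have "(\<Sum>I\<in>?Lo. (- 1) ^ card I * of_nat ((n - k - card I - 1) choose (k - card I))
          * of_nat (n - 2 * card I) * (\<Sum>i = 1..n. of_int (\<delta> I i) * X i) ^ d)
      = (\<Sum>I\<in>?Lo. \<Sum>f\<in>?E.
          of_int ((- 1) ^ card I * w I * (\<Prod>j<d. \<delta> I (f j))) * (\<Prod>j<d. X (f j)))"
    by (intro sum.cong refl)
       (simp add: sum_power_eq_sum_PiE sum_distrib_left w_def prod.distrib mult.assoc)
  also have "\<dots> = (\<Sum>f\<in>?E.
      of_int (\<Sum>I\<in>?Lo. (- 1) ^ card I * w I * (\<Prod>j<d. \<delta> I (f j))) * (\<Prod>j<d. X (f j)))"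
    by (subst sum.swap) (simp add: sum_distrib_right)
  also have "\<dots> = (\<Sum>f\<in>?E. if inj_on f {..<d}
      then 2 ^ d * of_nat (n - d) * (\<Prod>j<d. X (f j)) else 0)"
  proof (intro sum.cong refl)
    fix f assume "f \<in> ?E"
    show "of_int (\<Sum>I\<in>?Lo. (- 1) ^ card I * w I * (\<Prod>j<d. \<delta> I (f j))) * (\<Prod>j<d. X (f j))
        = (if inj_on f {..<d} then 2 ^ d * of_nat (n - d) * (\<Prod>j<d. X (f j)) else 0)"
      unfolding coeff[OF \<open>f \<in> ?E\<close>] by simp
  qed
  also have "\<dots> = (\<Sum>f | f \<in> ?E \<and> inj_on f {..<d}. 2 ^ d * of_nat (n - d) * (\<Prod>j<d. X (f j)))"
    by (rule sum.inter_filter[OF finE, symmetric])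
  also have "\<dots> = 2 ^ d * of_nat (n - d) * (of_nat (fact d) * elem_sym d n)"
    by (simp add: sum_prod_over_injections elem_sym_def flip: sum_distrib_left)
  finally show ?thesis
    by (simp add: mult.assoc)
qed

end
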